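(* Let $f:\mathbb{R}^n\to(-\infty,\infty]$ be a proper closed convex function that is a KL function with an exponent of $\alpha\in(0,\frac23)$. Suppose further that $f$ is continuous on $\mathrm{dom}\,\partial f$. Fix $\lambda>0$ and consider $$F_\lambda(x):=\inf_{y\in\mathbb{R}^n}\left\{f(y)+\frac{1}{2\lambda}\|y-x\|^2\right\}.$$ Then $F_\lambda$ is a KL function with an exponent of $\max\left\{\frac12,\frac{\alpha}{2-2\alpha}\right\}<1$.
   Context: Closed means lower semicontinuous; proper means never $-\infty$ and not identically $+\infty$. For convex $f$, $\partial f$ is the usual convex subdifferential, and for a differentiable convex function it is the gradient. $\mathrm{dom}\,\partial f=\{x:\partial f(x)\ne\emptyset\}$. "$f$ is continuous on a set $S$" means that the restriction of $f$ to $S$ is continuous. A proper closed function $f$ has the KL property at $\bar x\in\mathrm{dom}\,\partial f$ with an exponent of $\alpha\in[0,1)$ if there exist $c,\epsilon>0$ and $\nu\in(0,\infty]$ such that $\mathrm{dist}(0,\partial f(x))\ge c\,(f(x)-f(\bar x))^\alpha$ whenever $\|x-\bar x\|\le\epsilon$ and $f(\bar x)<f(x)<f(\bar x)+\nu$ (with $\mathrm{dist}(0,\emptyset)=+\infty$). It is a KL function with an exponent of $\alpha$ if it has the KL property with exponent $\alpha$ at every $\bar x\in\mathrm{dom}\,\partial f$. *)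

theory Defs
  imports "HOL-Analysis.Analysis"
begin

definition proper_fun :: "('a \<Rightarrow> ereal) \<Rightarrow> bool" where
  "proper_fun f \<longleftrightarrow> (\<forall>x. f x \<noteq> -\<infinity>) \<and> (\<exists>x. f x \<noteq> \<infinity>)"

definition lsc_fun :: "('a::topological_space \<Rightarrow> ereal) \<Rightarrow> bool" where
  "lsc_fun f \<longleftrightarrow> (\<forall>x. f x \<le> Liminf (at x) f)"

(* The library's convex_on covers real-valued functions only.  Meant for functions that never
   take the value -\<infinity>; note that 0 * \<infinity> = 0 in ereal, so u = 0 or v = 0 gives a trivial constraint. *)
definition convex_fun :: "('a::real_vector \<Rightarrow> ereal) \<Rightarrow> bool" where
  "convex_fun f \<longleftrightarrow>
    (\<forall>x y. \<forall>u v::real. 0 \<le> u \<longrightarrow> 0 \<le> v \<longrightarrow> u + v = 1 \<longrightarrow>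
      f (u *\<^sub>R x + v *\<^sub>R y) \<le> ereal u * f x + ereal v * f y)"

(* Subdifferential of convex analysis; empty wherever f is not finite. *)
definition subdiff :: "('a::real_inner \<Rightarrow> ereal) \<Rightarrow> 'a \<Rightarrow> 'a set" where
  "subdiff f x = {g. \<bar>f x\<bar> \<noteq> \<infinity> \<and> (\<forall>y. f x + ereal (g \<bullet> (y - x)) \<le> f y)}"

definition dom_subdiff :: "('a::real_inner \<Rightarrow> ereal) \<Rightarrow> 'a set" where
  "dom_subdiff f = {x. subdiff f x \<noteq> {}}"

(* The library's infdist and setdist give 0 for the empty set; here the distance to it is \<infinity>. *)
definition edist_set :: "'a::metric_space \<Rightarrow> 'a set \<Rightarrow> ereal" where
  "edist_set x S = (INF s\<in>S. ereal (dist x s))"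

(* For z \<in> dom_subdiff f and x with f z < f x < f z + \<nu>, both values are finite and their
   difference is positive, so real_of_ereal and powr have their intended meaning. *)
definition KL_property_at :: "('a::real_inner \<Rightarrow> ereal) \<Rightarrow> real \<Rightarrow> 'a \<Rightarrow> bool" where
  "KL_property_at f \<alpha> z \<longleftrightarrow>
    (\<exists>c \<epsilon> :: real. \<exists>\<nu> :: ereal. 0 < c \<and> 0 < \<epsilon> \<and> 0 < \<nu> \<and>
      (\<forall>x. norm (x - z) \<le> \<epsilon> \<longrightarrow> f z < f x \<longrightarrow> f x < f z + \<nu> \<longrightarrow>
        edist_set 0 (subdiff f x) \<ge> ereal (c * real_of_ereal (f x - f z) powr \<alpha>)))"

(* subdiff is the convex subdifferential, so this is the intended notion for convex f. *)
definition KL_function :: "('a::real_inner \<Rightarrow> ereal) \<Rightarrow> real \<Rightarrow> bool" where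
  "KL_function f \<alpha> \<longleftrightarrow>
    proper_fun f \<and> lsc_fun f \<and> 0 \<le> \<alpha> \<and> \<alpha> < 1 \<and>
    (\<forall>z \<in> dom_subdiff f. KL_property_at f \<alpha> z)"

definition moreau_envelope ::
    "real \<Rightarrow> ('a::real_normed_vector \<Rightarrow> ereal) \<Rightarrow> 'a \<Rightarrow> ereal" where
  "moreau_envelope lam f x = (INF y. f y + ereal (1 / (2 * lam) * (norm (y - x))\<^sup>2))"

end

theory Submission
  imports Defs
begin

text \<open>
  Write \<open>F\<close> for the Moreau envelope of \<open>f\<close>. The infimum defining \<open>F x\<close> is attained at some \<open>y\<close>
  (\<open>moreau_envelope_attained\<close>), and every subgradient \<open>g\<close> of \<open>F\<close> at \<open>x\<close> satisfies
  \<open>x - y = lam *\<^sub>R g\<close> and is also a subgradient of \<open>f\<close> at \<open>y\<close> (\<open>subdiff_moreau_envelope\<close>). So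
  the size of \<open>g\<close> can be bounded below by the KL inequality of \<open>f\<close> at \<open>y\<close>.

  If \<open>z\<close> does not minimise \<open>F\<close>, the subgradient inequality keeps \<open>g\<close> away from \<open>0\<close> for \<open>x\<close> near \<open>z\<close>,
  and every nonnegative exponent works (\<open>KL_property_at_nonminimizer\<close>). If \<open>z\<close> minimises \<open>F\<close>, it also
  minimises \<open>f\<close>, with the same value, and
  \<open>F x - F z = (f y - f z) + lam / 2 * (norm g)\<^sup>2\<close>.
  One of the two summands is at least half of the left-hand side. If it is the first, the KL
  inequality of \<open>f\<close> gives \<open>norm g \<ge> const * (F x - F z) powr \<alpha>\<close>; if it is the second, the same
  holds with exponent \<open>1 / 2\<close>. Hence \<open>F\<close> has the KL property at \<open>z\<close> with every exponent that is
  at least \<open>max (1 / 2) \<alpha>\<close> (\<open>KL_property_at_moreau_envelope_minimizer\<close>). The exponent in the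
  theorem qualifies: \<open>\<alpha> \<le> \<alpha> / (2 - 2 * \<alpha>)\<close> as soon as \<open>\<alpha> \<ge> 1 / 2\<close>. It is smaller than \<open>1\<close>
  precisely because \<open>\<alpha> < 2 / 3\<close>.
\<close>

section \<open>Lower semicontinuous functions\<close>

lemma lsc_fun_eventually_gt:
  fixes f :: "'a::t2_space \<Rightarrow> ereal"
  assumes "lsc_fun f" "a < f x"
  shows "eventually (\<lambda>y. a < f y) (nhds x)"
proof -
  have "a < Liminf (at x) f"
    using assms unfolding lsc_fun_def by (meson less_le_trans)
  then have "eventually (\<lambda>y. a < f y) (at x)"
    by (rule less_LiminfD)
  then show ?thesis
    using assms(2) by (auto simp: eventually_at_filter elim: eventually_mono)
qed

text \<open>
  If no point of the compact set were a minimiser, the open sets \<open>{y. f w < f y}\<close> would cover it.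
  The best of the finitely many \<open>w\<close> of a subcover is then in none of its sets.
\<close>

lemma lsc_fun_attains_min:
  fixes f :: "'a::t2_space \<Rightarrow> ereal"
  assumes lsc: "lsc_fun f" and K: "compact K" "K \<noteq> {}"
  shows "\<exists>w\<in>K. \<forall>y\<in>K. f w \<le> f y"
proof (rule ccontr)
  assume "\<not> ?thesis"
  then have no_min: "\<forall>y\<in>K. \<exists>w\<in>K. f w < f y"
    by (simp add: not_le)
  have "open {y. a < f y}" for a
    using lsc_fun_eventually_gt[OF lsc, of a]
    by (subst open_subopen) (fastforce simp: eventually_nhds)
  moreover have "K \<subseteq> (\<Union>w\<in>K. {y. f w < f y})"
    using no_min by blast
  ultimately obtain T where T: "T \<subseteq> K" "finite T" "K \<subseteq> (\<Union>w\<in>T. {y. f w < f y})"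
    using compactE_image[OF K(1), of K "\<lambda>w. {y. f w < f y}"] by metis
  have "T \<noteq> {}" using T(3) K(2) by auto
  then obtain w where w: "w \<in> T" "\<not> (\<exists>v\<in>T. f v < f w)"
    using arg_min_if_finite[OF T(2), of f] by blast
  then show False using T by blast
qed

lemma lsc_fun_add_continuous:
  fixes f :: "'a::t2_space \<Rightarrow> ereal" and h :: "'a \<Rightarrow> real"
  assumes lsc: "lsc_fun f" and h: "\<And>x. isCont h x"
  shows "lsc_fun (\<lambda>x. f x + ereal (h x))"
  unfolding lsc_fun_def
proof (intro allI)
  fix x
  show "f x + ereal (h x) \<le> Liminf (at x) (\<lambda>x. f x + ereal (h x))"
    unfolding le_Liminf_iff
  proof (intro allI impI)
    fix a assume a: "a < f x + ereal (h x)"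
    then obtain b where b: "a < ereal b" "ereal b < f x + ereal (h x)"
      using ereal_dense2 by blast
    then have "ereal (b - h x) < f x" by (cases "f x") auto
    then obtain c where c: "ereal (b - h x) < ereal c" "ereal c < f x"
      using ereal_dense2 by blast
    have "eventually (\<lambda>y. ereal c < f y) (at x)"
      using lsc_fun_eventually_gt[OF lsc c(2)] unfolding eventually_nhds_conv_at by blast
    moreover have "eventually (\<lambda>y. b - c < h y) (at x)"
      using h[of x] c(1) unfolding isCont_def by (intro order_tendstoD(1)) auto
    ultimately show "eventually (\<lambda>y. a < f y + ereal (h y)) (at x)"
    proof eventually_elim
      case (elim y)
      then have "ereal b \<le> f y + ereal (h y)" by (cases "f y") auto
      with b(1) show ?case by (rule less_le_trans)
    qed
  qed
qed

text \<open>
  On the unit ball around \<open>y0\<close> the function is bounded below by compactness, by \<open>m\<close> say. For \<open>y\<close>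
  outside this ball, the segment from \<open>y0\<close> to \<open>y\<close> crosses the unit sphere, where the value is still
  at least \<open>m\<close>; up to there \<open>f\<close> has dropped with slope at most \<open>b - m\<close>, and by convexity it cannot
  drop faster afterwards.
\<close>

lemma convex_lsc_linear_lower_bound:
  fixes f :: "'a::euclidean_space \<Rightarrow> ereal"
  assumes proper: "proper_fun f" and lsc: "lsc_fun f" and conv: "convex_fun f"
    and b: "f y0 = ereal b"
  obtains K where "0 \<le> K" "\<And>y. ereal (b - K * (1 + norm (y - y0))) \<le> f y"
proof -
  obtain w0 where w0: "\<And>y. y \<in> cball y0 1 \<Longrightarrow> f w0 \<le> f y"
    using lsc_fun_attains_min[OF lsc compact_cball, of y0 1] by force
  have "f w0 \<le> ereal b" "f w0 \<noteq> -\<infinity>"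
    using w0[of y0] b proper by (auto simp: proper_fun_def)
  then obtain m where m: "f w0 = ereal m" "m \<le> b"
    by (cases "f w0") auto
  show ?thesis
  proof (rule that[of "b - m"])
    fix y
    define r where "r = norm (y - y0)"
    show "ereal (b - (b - m) * (1 + norm (y - y0))) \<le> f y"
    proof (cases "r \<le> 1")
      case True
      then have "ereal m \<le> f y"
        using w0[of y] m by (auto simp: r_def dist_norm norm_minus_commute)
      moreover have "b - (b - m) * (1 + norm (y - y0)) \<le> m"
        using m(2) by (simp add: algebra_simps mult_right_mono)
      ultimately show ?thesis by (meson ereal_less_eq(3) order_trans)
    next
      case False
      define w where "w = (1 - 1/r) *\<^sub>R y0 + (1/r) *\<^sub>R y"
      have "w - y0 = (1/r) *\<^sub>R (y - y0)"
        by (simp add: w_def algebra_simps)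
      then have "norm (w - y0) = 1" using False by (auto simp: r_def)
      then have "ereal m \<le> f w"
        using w0[of w] m by (auto simp: dist_norm norm_minus_commute)
      also have "\<dots> \<le> ereal (1 - 1/r) * f y0 + ereal (1/r) * f y"
        using conv False unfolding convex_fun_def w_def by simp
      finally have le: "ereal m \<le> ereal (1 - 1/r) * ereal b + ereal (1/r) * f y"
        using b by simp
      show ?thesis
      proof (cases "f y")
        case (real s)
        then have "m \<le> (1 - 1/r) * b + (1/r) * s" using le by simp
        then have "r * m \<le> r * ((1 - 1/r) * b + (1/r) * s)"
          using False by (intro mult_left_mono) auto
        also have "\<dots> = (r - 1) * b + s" using False by (simp add: field_simps)
        finally have "b - (b - m) * r \<le> s" by (simp add: algebra_simps)
        then show ?thesis using m(2) real by (simp add: r_def[symmetric] algebra_simps)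
      qed (use proper in \<open>auto simp: proper_fun_def\<close>)
    qed
  qed (use m in auto)
qed

section \<open>The Moreau envelope and its subgradients\<close>

lemma moreau_envelope_le:
  "moreau_envelope lam f x \<le> f y + ereal (1 / (2 * lam) * (norm (y - x))\<^sup>2)"
  unfolding moreau_envelope_def by (rule INF_lower) simp

lemma moreau_envelope_le_self: "moreau_envelope lam f x \<le> f x"
  using moreau_envelope_le[of lam f x x] by (simp flip: zero_ereal_def)

text \<open>
  Since \<open>f\<close> falls off at most linearly, the quadratic term dominates outside a large ball, and the
  infimum reduces to a minimum over that ball. The value \<open>b\<close> of \<open>f\<close> at the minimiser is real, so the
  envelope is finite everywhere.
\<close>

lemma moreau_envelope_attained:
  fixes f :: "'a::euclidean_space \<Rightarrow> ereal"
  assumes proper: "proper_fun f" and lsc: "lsc_fun f" and conv: "convex_fun f"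
    and lam: "0 < lam"
  obtains y b where "f y = ereal b"
    "moreau_envelope lam f x = ereal (b + 1 / (2 * lam) * (norm (y - x))\<^sup>2)"
proof -
  define q where "q y = 1 / (2 * lam) * (norm (y - x))\<^sup>2" for y
  obtain y0 b0 where b0: "f y0 = ereal b0"
    using proper unfolding proper_fun_def by (metis ereal_cases)
  obtain K where K: "0 \<le> K" "\<And>y. ereal (b0 - K * (1 + norm (y - y0))) \<le> f y"
    using convex_lsc_linear_lower_bound[OF proper lsc conv b0] by blast
  define d where "d = norm (x - y0)"
  \<comment> \<open>At distance \<open>r \<ge> R\<close> from \<open>x\<close>: the first bound keeps \<open>y0\<close> inside the ball, the second gives
    \<open>q y \<ge> (K + 1) * r\<close>, and the third lets the spare \<open>r\<close> absorb the constants.\<close>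
  define R where "R = Max {d, 2 * lam * (K + 1), K * (1 + d) + q y0}"
  have R: "d \<le> R" "2 * lam * (K + 1) \<le> R" "K * (1 + d) + q y0 \<le> R"
    by (auto simp: R_def)
  have far: "f y0 + ereal (q y0) \<le> f y + ereal (q y)" if "y \<notin> cball x R" for y
  proof -
    define r where "r = norm (y - x)"
    have r: "R \<le> r" "0 \<le> r"
      using that by (auto simp: r_def dist_norm norm_minus_commute)
    have "norm (y - y0) \<le> r + d"
      using norm_triangle_ineq[of "y - x" "x - y0"] by (simp add: r_def d_def)
    then have "K * (1 + norm (y - y0)) \<le> K * (1 + (r + d))"
      using K(1) by (intro mult_left_mono) auto
    moreover have "(K + 1) * r \<le> q y"
    proof -
      have "2 * lam * (K + 1) * r \<le> r * r"
        using R(2) r by (intro mult_right_mono) auto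
      then have "2 * lam * (K + 1) * r / (2 * lam) \<le> r * r / (2 * lam)"
        using lam by (intro divide_right_mono) auto
      then show ?thesis
        using lam by (simp add: q_def r_def[symmetric] power2_eq_square)
    qed
    ultimately have "b0 + q y0 \<le> b0 - K * (1 + norm (y - y0)) + q y"
      using R(3) r by (simp add: algebra_simps)
    then show ?thesis
      using K(2)[of y] b0 by (cases "f y") auto
  qed
  have "lsc_fun (\<lambda>y. f y + ereal (q y))"
    by (rule lsc_fun_add_continuous[OF lsc]) (use lam in \<open>auto simp: q_def[abs_def] intro!: continuous_intros\<close>)
  moreover have y0: "y0 \<in> cball x R"
    using R(1) by (simp add: d_def dist_norm)
  ultimately obtain y where y: "\<And>w. w \<in> cball x R \<Longrightarrow> f y + ereal (q y) \<le> f w + ereal (q w)"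
    using lsc_fun_attains_min[OF _ compact_cball, of "\<lambda>y. f y + ereal (q y)" x R] by blast
  then have min: "f y + ereal (q y) \<le> f w + ereal (q w)" for w
    using y[OF y0] far[of w] by (cases "w \<in> cball x R") (auto intro: order_trans)
  obtain b where b: "f y = ereal b"
    using y[OF y0] b0 proper unfolding proper_fun_def by (cases "f y") auto
  have "f y + ereal (q y) \<le> moreau_envelope lam f x"
    unfolding moreau_envelope_def using min by (intro INF_greatest) (simp add: q_def)
  then have "moreau_envelope lam f x = ereal (b + q y)"
    using moreau_envelope_le[of lam f x y] b by (simp add: q_def antisym)
  with b show ?thesis using that by (simp add: q_def)
qed

text \<open>
  Two upper bounds for the envelope near \<open>x\<close> touch it at \<open>x\<close>. Keeping \<open>y\<close> fixed bounds it by a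
  quadratic with gradient \<open>(x - y) / lam\<close> at \<open>x\<close>, which determines \<open>g\<close>. Moving \<open>y\<close> together with
  \<open>x\<close> bounds it by a translate of \<open>f\<close>, so that the subgradient inequality passes to \<open>f\<close> at \<open>y\<close>.
\<close>

lemma subdiff_moreau_envelope:
  fixes f :: "'a::real_inner \<Rightarrow> ereal"
  assumes lam: "0 < lam" and b: "f y = ereal b"
    and F: "moreau_envelope lam f x = ereal (b + 1 / (2 * lam) * (norm (y - x))\<^sup>2)"
    and g: "g \<in> subdiff (moreau_envelope lam f) x"
  shows "x - y = lam *\<^sub>R g" "g \<in> subdiff f y"
proof -
  have sub: "ereal (b + 1 / (2 * lam) * (norm (y - x))\<^sup>2 + g \<bullet> (x' - x))
      \<le> moreau_envelope lam f x'" for x'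
    using g F unfolding subdiff_def by (auto simp: add.assoc)
  \<comment> \<open>The minimiser of the quadratic majorant minus the linear minorant, a difference
    that must stay nonnegative and vanishes at displacement \<open>0\<close>.\<close>
  define d where "d = lam *\<^sub>R g - (x - y)"
  have "ereal (b + 1 / (2 * lam) * (norm (y - x))\<^sup>2 + g \<bullet> d)
      \<le> ereal (b + 1 / (2 * lam) * (norm (y - (x + d)))\<^sup>2)"
    using order_trans[OF sub[of "x + d"] moreau_envelope_le[of lam f "x + d" y]] b by simp
  then have "1 / (2 * lam) * ((norm (y - x))\<^sup>2 + 2 * (lam * (g \<bullet> d)))
      \<le> 1 / (2 * lam) * (norm (y - (x + d)))\<^sup>2"
    using lam by (simp add: distrib_left)
  then have "(norm (y - x))\<^sup>2 + 2 * (lam * (g \<bullet> d)) \<le> (norm (y - (x + d)))\<^sup>2"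
    using lam by (subst (asm) mult_le_cancel_left_pos) auto
  moreover have "lam * (g \<bullet> d) = d \<bullet> d + (x - y) \<bullet> d"
    by (simp add: d_def inner_diff_left)
  moreover have "(norm (y - (x + d)))\<^sup>2 = (norm (y - x))\<^sup>2 + 2 * ((x - y) \<bullet> d) + d \<bullet> d"
    by (simp add: power2_norm_eq_inner inner_diff_left inner_diff_right inner_add_left
        inner_add_right inner_commute)
  ultimately have "d \<bullet> d \<le> 0" by simp
  then have "d = 0" by (metis inner_gt_zero_iff not_le)
  then show "x - y = lam *\<^sub>R g" by (simp add: d_def)
  have "f y + ereal (g \<bullet> (w - y)) \<le> f w" for w
  proof -
    have "ereal (b + 1 / (2 * lam) * (norm (y - x))\<^sup>2 + g \<bullet> (w - y))
        \<le> f w + ereal (1 / (2 * lam) * (norm (y - x))\<^sup>2)"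
      using order_trans[OF sub[of "x + (w - y)"] moreau_envelope_le[of lam f _ w]]
      by (simp add: algebra_simps)
    then show ?thesis using b by (cases "f w") auto
  qed
  then show "g \<in> subdiff f y" using b by (simp add: subdiff_def)
qed

text \<open>
  The envelope is a partial minimum of a jointly convex function: the convex combination of
  minimisers for \<open>x\<close> and \<open>x'\<close> is a competitor at the convex combination of \<open>x\<close> and \<open>x'\<close>.
\<close>

lemma convex_on_moreau_envelope:
  fixes f :: "'a::euclidean_space \<Rightarrow> ereal"
  assumes proper: "proper_fun f" and lsc: "lsc_fun f" and conv: "convex_fun f"
    and lam: "0 < lam"
  shows "convex_on UNIV (\<lambda>x. real_of_ereal (moreau_envelope lam f x))"
proof (rule convex_onI)
  fix t x x' :: _
  assume t: "0 < (t::real)" "t < 1"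
  obtain y b where y: "f y = ereal b"
      "moreau_envelope lam f x = ereal (b + 1 / (2 * lam) * (norm (y - x))\<^sup>2)"
    using moreau_envelope_attained[OF proper lsc conv lam] by blast
  obtain y' b' where y': "f y' = ereal b'"
      "moreau_envelope lam f x' = ereal (b' + 1 / (2 * lam) * (norm (y' - x'))\<^sup>2)"
    using moreau_envelope_attained[OF proper lsc conv lam] by blast
  define xt yt where "xt = (1 - t) *\<^sub>R x + t *\<^sub>R x'" and "yt = (1 - t) *\<^sub>R y + t *\<^sub>R y'"
  obtain c where c: "moreau_envelope lam f xt = ereal c"
    using moreau_envelope_attained[OF proper lsc conv lam] by blast
  have "yt - xt = (1 - t) *\<^sub>R (y - x) + t *\<^sub>R (y' - x')"
    by (simp add: xt_def yt_def algebra_simps)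
  then have "norm (yt - xt) \<le> (1 - t) * norm (y - x) + t * norm (y' - x')"
    using norm_triangle_ineq[of "(1 - t) *\<^sub>R (y - x)" "t *\<^sub>R (y' - x')"] t by simp
  then have "(norm (yt - xt))\<^sup>2 \<le> ((1 - t) * norm (y - x) + t * norm (y' - x'))\<^sup>2"
    by (rule power_mono) simp
  also have "\<dots> \<le> (1 - t) * (norm (y - x))\<^sup>2 + t * (norm (y' - x'))\<^sup>2"
    using convex_onD[OF convex_power2, of t "norm (y - x)" "norm (y' - x')"] t by simp
  finally have q: "1 / (2 * lam) * (norm (yt - xt))\<^sup>2
      \<le> 1 / (2 * lam) * ((1 - t) * (norm (y - x))\<^sup>2 + t * (norm (y' - x'))\<^sup>2)"
    using lam by (intro mult_left_mono) auto
  have "f yt \<le> ereal (1 - t) * f y + ereal t * f y'"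
    using conv t unfolding convex_fun_def yt_def by simp
  then have "f yt \<le> ereal ((1 - t) * b + t * b')" using y y' by simp
  then have "ereal c \<le> ereal ((1 - t) * b + t * b') + ereal (1 / (2 * lam) * (norm (yt - xt))\<^sup>2)"
    using moreau_envelope_le[of lam f xt yt] c by (metis add_right_mono order_trans)
  then have "c \<le> (1 - t) * b + t * b' + 1 / (2 * lam) * (norm (yt - xt))\<^sup>2" by simp
  also have "\<dots> \<le> (1 - t) * (b + 1 / (2 * lam) * (norm (y - x))\<^sup>2)
      + t * (b' + 1 / (2 * lam) * (norm (y' - x'))\<^sup>2)"
    using q by (simp add: algebra_simps diff_divide_distrib)
  finally show "real_of_ereal (moreau_envelope lam f ((1 - t) *\<^sub>R x + t *\<^sub>R x'))
      \<le> (1 - t) * real_of_ereal (moreau_envelope lam f x)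
        + t * real_of_ereal (moreau_envelope lam f x')"
    using c y y' by (simp add: xt_def)
qed simp

text \<open>
  A finite convex function on a finite-dimensional space is continuous.
\<close>

lemma lsc_fun_moreau_envelope:
  fixes f :: "'a::euclidean_space \<Rightarrow> ereal"
  assumes "proper_fun f" "lsc_fun f" "convex_fun f" "0 < lam"
  shows "lsc_fun (moreau_envelope lam f)"
proof -
  define G where "G x = real_of_ereal (moreau_envelope lam f x)" for x
  have F: "moreau_envelope lam f = (\<lambda>x. ereal (G x))"
    using moreau_envelope_attained[OF assms] unfolding G_def
    by (metis real_of_ereal.simps(1))
  have "continuous_on UNIV G"
    unfolding G_def
    by (rule convex_on_continuous[OF open_UNIV convex_on_moreau_envelope[OF assms]])
  then have "isCont G x" for x by (simp add: continuous_on_eq_continuous_at)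
  then show ?thesis
    unfolding lsc_fun_def F isCont_def
    by (metis lim_imp_Liminf tendsto_ereal trivial_limit_at order_refl)
qed

section \<open>The KL property\<close>

lemma edist_set_0_ge:
  fixes S :: "'a::real_normed_vector set"
  assumes "\<And>g. g \<in> S \<Longrightarrow> k \<le> norm g"
  shows "ereal k \<le> edist_set 0 S"
  unfolding edist_set_def using assms by (intro INF_greatest) simp

text \<open>
  A subgradient \<open>g\<close> at \<open>x\<close> has to account for the decrease from \<open>f x > f z\<close> to the smaller value
  \<open>f u\<close>, so \<open>norm g\<close> is at least \<open>(s - r) / norm (x - u)\<close>. For \<open>x\<close> near \<open>z\<close> this is bounded away
  from \<open>0\<close>, whereas \<open>(f x - f z) powr \<beta>\<close> is at most \<open>1\<close> within the level band of height \<open>1\<close>.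
\<close>

lemma KL_property_at_nonminimizer:
  fixes f :: "'a::real_inner \<Rightarrow> ereal"
  assumes z: "f z = ereal s" and u: "f u = ereal r" and less: "r < s" and \<beta>: "0 \<le> \<beta>"
  shows "KL_property_at f \<beta> z"
proof -
  define c where "c = (s - r) / (norm (z - u) + 1)"
  have c: "0 < c" using less by (simp add: c_def add_nonneg_pos)
  have "ereal (c * real_of_ereal (f x - f z) powr \<beta>) \<le> edist_set 0 (subdiff f x)"
    if x: "norm (x - z) \<le> 1" "f z < f x" "f x < f z + 1" for x
  proof (rule edist_set_0_ge)
    fix g assume g: "g \<in> subdiff f x"
    obtain a where a: "f x = ereal a" "s < a" "a < s + 1"
      using x z by (cases "f x") (auto simp: one_ereal_def)
    have "a + g \<bullet> (u - x) \<le> r"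
      using g a u by (auto simp: subdiff_def dest!: spec[of _ u])
    then have "s - r \<le> g \<bullet> (x - u)"
      using a(2) by (simp add: inner_diff_right)
    also have "\<dots> \<le> norm g * norm (x - u)" by (rule norm_cauchy_schwarz)
    also have "\<dots> \<le> norm g * (norm (z - u) + 1)"
      using norm_triangle_ineq[of "x - z" "z - u"] x(1) by (intro mult_left_mono) auto
    finally have "c \<le> norm g"
      by (simp add: c_def divide_le_eq add_nonneg_pos)
    moreover have "(a - s) powr \<beta> \<le> 1" using a \<beta> by (intro powr_le1) auto
    ultimately have "c * (a - s) powr \<beta> \<le> norm g"
      using c mult_left_le[of "(a - s) powr \<beta>" c] by linarith
    then show "c * real_of_ereal (f x - f z) powr \<beta> \<le> norm g"
      using a z by simp
  qed
  then show ?thesis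
    unfolding KL_property_at_def using c
    by (intro exI[of _ c] exI[of _ "1::real"] exI[of _ "1::ereal"]) auto
qed

text \<open>
  Here \<open>a\<close> and \<open>b\<close> stand for the excess of the envelope and of the function over their common
  minimum, and \<open>n\<close> for the norm of the subgradient. The case distinction is on which summand of \<open>a\<close>
  is at least \<open>a / 2\<close>. Since \<open>a \<le> 1\<close>, raising the exponent to \<open>\<beta>\<close> only lowers the power of \<open>a\<close>.
\<close>

lemma KL_bound_of_splitting:
  fixes a b c lam n \<alpha> \<beta> :: real
  assumes a: "0 < a" "a \<le> 1" "a = b + lam / 2 * n\<^sup>2"
    and n: "0 \<le> n" "0 < b \<Longrightarrow> c * b powr \<alpha> \<le> n"
    and "0 < c" "0 < lam" "0 \<le> \<alpha>" "\<alpha> \<le> \<beta>" "1 / 2 \<le> \<beta>"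
  shows "min (c * (1 / 2) powr \<alpha>) (1 / sqrt lam) * a powr \<beta> \<le> n"
proof (cases "a / 2 \<le> b")
  case True
  have "min (c * (1 / 2) powr \<alpha>) (1 / sqrt lam) * a powr \<beta> \<le> c * (1 / 2) powr \<alpha> * a powr \<alpha>"
    using assms by (intro mult_mono powr_mono') auto
  also have "\<dots> = c * (a / 2) powr \<alpha>"
    using a by (simp add: powr_divide)
  also have "\<dots> \<le> c * b powr \<alpha>"
    using True assms by (intro mult_left_mono powr_mono2) auto
  also have "\<dots> \<le> n" using True a n by simp
  finally show ?thesis .
next
  case False
  then have "a / lam \<le> n\<^sup>2" using a \<open>0 < lam\<close> by (simp add: field_simps)
  have "min (c * (1 / 2) powr \<alpha>) (1 / sqrt lam) * a powr \<beta> \<le> 1 / sqrt lam * a powr (1 / 2)"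
    using assms by (intro mult_mono powr_mono') auto
  also have "\<dots> = sqrt (a / lam)"
    using a by (simp add: powr_half_sqrt real_sqrt_divide)
  also have "\<dots> \<le> n"
    using \<open>a / lam \<le> n\<^sup>2\<close> n(1) by (rule real_le_lsqrt[rotated])
  finally show ?thesis .
qed

text \<open>
  To apply the KL inequality of \<open>f\<close> at the point \<open>y\<close> where the infimum for \<open>x\<close> is attained, \<open>y\<close> must
  be close to \<open>z\<close> in position and in value. The former holds because \<open>z\<close> minimises \<open>f\<close>, which forces
  \<open>g \<bullet> (y - z) \<ge> 0\<close> and hence \<open>norm (y - z) \<le> norm (x - z)\<close>; the latter because
  \<open>f y \<le> F x\<close> while \<open>f z = F z\<close>.
\<close>

lemma KL_property_at_moreau_envelope_minimizer:
  fixes f :: "'a::euclidean_space \<Rightarrow> ereal"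
  assumes proper: "proper_fun f" and lsc: "lsc_fun f" and conv: "convex_fun f"
    and lam: "0 < lam" and KL: "KL_function f \<alpha>"
    and \<beta>: "\<alpha> \<le> \<beta>" "1 / 2 \<le> \<beta>"
    and min: "\<And>u. moreau_envelope lam f z \<le> moreau_envelope lam f u"
  shows "KL_property_at (moreau_envelope lam f) \<beta> z"
proof -
  let ?F = "moreau_envelope lam f"
  have fz: "f z = ?F z"
  proof -
    obtain y b where y: "f y = ereal b" "?F z = ereal (b + 1 / (2 * lam) * (norm (y - z))\<^sup>2)"
      using moreau_envelope_attained[OF proper lsc conv lam] by blast
    then have "b + 1 / (2 * lam) * (norm (y - z))\<^sup>2 \<le> b"
      using order_trans[OF min[of y] moreau_envelope_le_self[of lam f y]] by simp
    then have "y = z" using lam by (simp add: field_simps)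
    with y show ?thesis by simp
  qed
  obtain s where s: "?F z = ereal s"
    using moreau_envelope_attained[OF proper lsc conv lam] by blast
  have fmin: "f z \<le> f w" for w
    using order_trans[OF min moreau_envelope_le_self] fz by simp
  then have "0 \<in> subdiff f z"
    using fz s by (simp add: subdiff_def flip: zero_ereal_def)
  then have "KL_property_at f \<alpha> z" and \<alpha>: "0 \<le> \<alpha>"
    using KL unfolding KL_function_def dom_subdiff_def by auto
  then obtain c \<epsilon> :: real and \<nu> :: ereal where pos: "0 < c" "0 < \<epsilon>" "0 < \<nu>"
    and KLz: "\<And>y. \<lbrakk>norm (y - z) \<le> \<epsilon>; f z < f y; f y < f z + \<nu>\<rbrakk>
      \<Longrightarrow> ereal (c * real_of_ereal (f y - f z) powr \<alpha>) \<le> edist_set 0 (subdiff f y)"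
    unfolding KL_property_at_def by blast
  define c' where "c' = min (c * (1 / 2) powr \<alpha>) (1 / sqrt lam)"
  have "ereal (c' * real_of_ereal (?F x - ?F z) powr \<beta>) \<le> edist_set 0 (subdiff ?F x)"
    if x: "norm (x - z) \<le> \<epsilon>" "?F z < ?F x" "?F x < ?F z + min \<nu> 1" for x
  proof (rule edist_set_0_ge)
    fix g assume g: "g \<in> subdiff ?F x"
    obtain y b where y: "f y = ereal b" "?F x = ereal (b + 1 / (2 * lam) * (norm (y - x))\<^sup>2)"
      using moreau_envelope_attained[OF proper lsc conv lam] by blast
    have gy: "x - y = lam *\<^sub>R g" "g \<in> subdiff f y"
      using subdiff_moreau_envelope[OF lam y g] by auto
    have "norm (y - x) = lam * norm g"
      using gy(1) lam by (simp add: norm_minus_commute)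
    then have Fx: "?F x = ereal (b + lam / 2 * (norm g)\<^sup>2)"
      using y(2) lam by (simp add: power_mult_distrib power2_eq_square)
    have "b + g \<bullet> (z - y) \<le> s" "s \<le> b"
      using gy(2) fmin[of y] fz s y(1) by (auto simp: subdiff_def dest!: spec[of _ z])
    then have "0 \<le> (lam *\<^sub>R g) \<bullet> (y - z)"
      using lam by (simp add: inner_diff_right)
    then have "(y - z) \<bullet> (y - z) \<le> (x - z) \<bullet> (y - z)"
      unfolding gy(1)[symmetric] by (simp add: inner_diff_left)
    also have "\<dots> \<le> norm (x - z) * norm (y - z)" by (rule norm_cauchy_schwarz)
    finally have near: "norm (y - z) \<le> norm (x - z)"
      by (cases "y = z") (auto simp: dot_square_norm power2_eq_square)
    have "f y < f z + \<nu>"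
    proof -
      have "f y \<le> ?F x" using y(1) Fx lam by simp
      also have "\<dots> < ?F z + \<nu>" using x(3) by (meson add_left_mono less_le_trans min.cobounded1)
      finally show ?thesis using fz by simp
    qed
    then have KLy: "c * (b - s) powr \<alpha> \<le> norm g" if "0 < b - s"
    proof -
      have "ereal (c * (b - s) powr \<alpha>) \<le> edist_set 0 (subdiff f y)"
        using KLz[of y] \<open>f y < f z + \<nu>\<close> near x(1) that fz s y(1) by auto
      also have "\<dots> \<le> ereal (norm g)"
        unfolding edist_set_def using INF_lower[OF gy(2), of "\<lambda>g. ereal (dist 0 g)"] by simp
      finally show ?thesis by simp
    qed
    define a where "a = b - s + lam / 2 * (norm g)\<^sup>2"
    have "?F x < ?F z + 1" using x(3) by (meson add_left_mono less_le_trans min.cobounded2)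
    then have "0 < a" "a \<le> 1" using x(2) Fx s by (auto simp: a_def one_ereal_def)
    then have "c' * a powr \<beta> \<le> norm g"
      unfolding c'_def
      by (rule KL_bound_of_splitting[OF _ _ a_def]) (use KLy pos lam \<alpha> \<beta> in auto)
    moreover have "real_of_ereal (?F x - ?F z) = a" using Fx s by (simp add: a_def)
    ultimately show "c' * real_of_ereal (?F x - ?F z) powr \<beta> \<le> norm g" by simp
  qed
  moreover have "0 < c'" using pos lam by (simp add: c'_def)
  ultimately show ?thesis
    unfolding KL_property_at_def using pos
    by (intro exI[of _ c'] exI[of _ \<epsilon>] exI[of _ "min \<nu> 1"]) auto
qed

theorem theorem3p4:
  fixes f :: "real ^ 'n \<Rightarrow> ereal" and \<alpha> lam :: real
  assumes "proper_fun f"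
    and "lsc_fun f"
    and "convex_fun f"
    and "0 < \<alpha>" and "\<alpha> < 2 / 3"
    and "KL_function f \<alpha>"
    and "continuous_on (dom_subdiff f) f"
    and "0 < lam"
  shows "KL_function (moreau_envelope lam f) (max (1 / 2) (\<alpha> / (2 - 2 * \<alpha>)))
    \<and> max (1 / 2) (\<alpha> / (2 - 2 * \<alpha>)) < 1"
proof -
  let ?F = "moreau_envelope lam f"
  define \<beta> where "\<beta> = max (1 / 2) (\<alpha> / (2 - 2 * \<alpha>))"
  have \<beta>1: "\<beta> < 1" using assms(5) by (simp add: \<beta>_def field_simps)
  have \<beta>2: "1 / 2 \<le> \<beta>" by (simp add: \<beta>_def)
  have \<beta>3: "\<alpha> \<le> \<beta>"
  proof (cases "\<alpha> \<le> 1 / 2")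
    case False
    then have "\<alpha> * (2 - 2 * \<alpha>) \<le> \<alpha> * 1" by (intro mult_left_mono) auto
    then have "\<alpha> \<le> \<alpha> / (2 - 2 * \<alpha>)" using assms(5) by (simp add: le_divide_eq)
    then show ?thesis by (simp add: \<beta>_def)
  qed (simp add: \<beta>_def)
  have finite: "\<exists>s. ?F x = ereal s" for x
    using moreau_envelope_attained[OF assms(1-3,8)] by blast
  then have proper: "proper_fun ?F"
    unfolding proper_fun_def by (metis MInfty_neq_ereal(1) PInfty_neq_ereal(1))
  have "KL_property_at ?F \<beta> z" for z
  proof (cases "\<forall>u. ?F z \<le> ?F u")
    case True
    then show ?thesis
      using KL_property_at_moreau_envelope_minimizer[OF assms(1-3,8,6) \<beta>3 \<beta>2] by blast
  next
    case False
    then obtain u where "?F u < ?F z" by (meson not_le)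
    moreover obtain r s where "?F u = ereal r" "?F z = ereal s" using finite by meson
    ultimately show ?thesis using KL_property_at_nonminimizer[of ?F z s u r \<beta>] \<beta>2 by simp
  qed
  then have "KL_function ?F \<beta>"
    unfolding KL_function_def
    using proper lsc_fun_moreau_envelope[OF assms(1-3,8)] \<beta>1 \<beta>2 by auto
  then show ?thesis using \<beta>1 by (simp add: \<beta>_def)
qed

end
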